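(* There exists an outerplanar graph that is not $(\frac{5}{2},1)^*$-colorable.
   Context: Graphs are finite, undirected and simple. An outerplanar graph is a graph with a planar drawing for which all vertices belong to the outer face of the drawing. For a positive integer $k$ and $i,j\in\{0,1,\dots,k-1\}$, the circular distance is $|i-j|_k=\min\{|i-j|,\,k-|i-j|\}$. For a nonnegative integer $t$, a $(\frac{k}{2},t)^*$-coloring of a graph $G$ is a mapping $f:V(G)\to\{0,1,\dots,k-1\}$ such that adjacent vertices receive different integers and, for each vertex $u$, the number of neighbors $v$ of $u$ with $|f(u)-f(v)|_k=1$ is at most $t$. $G$ is $(\frac{k}{2},t)^*$-colorable if it has such a coloring. *)

theory Defs
  imports "HOL-Analysis.Analysis" "Graph_Theory.Pair_Digraph"
begin

text \<open>
  A finite simple undirected graph is a \<^locale>\<open>pair_graph\<close>: a finite vertex set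
  \<^term>\<open>pverts G\<close> with a symmetric irreflexive relation \<^term>\<open>parcs G\<close>, so that each
  undirected edge \<open>uv\<close> is represented by the two arcs \<open>(u, v)\<close> and \<open>(v, u)\<close>.
\<close>

text \<open>
  Planar drawings: \<open>p\<close> places the vertices, and \<open>g (u, v)\<close> is a parametrisation from \<open>p u\<close> to
  \<open>p v\<close> of the simple arc drawn for the edge \<open>uv\<close>. The reversal condition makes the two arcs
  representing an edge have the same image. An edge meets the vertices only in its two ends,
  and two different edges meet only in common ends.
\<close>

definition planar_drawing ::
    "'a pair_pre_digraph \<Rightarrow> ('a \<Rightarrow> complex) \<Rightarrow> ('a \<times> 'a \<Rightarrow> real \<Rightarrow> complex) \<Rightarrow> bool" where
  "planar_drawing G p g \<longleftrightarrow>
     inj_on p (pverts G) \<and>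
     (\<forall>(u, v) \<in> parcs G.
        arc (g (u, v)) \<and> pathstart (g (u, v)) = p u \<and> pathfinish (g (u, v)) = p v \<and>
        g (v, u) = reversepath (g (u, v)) \<and>
        path_image (g (u, v)) \<inter> p ` pverts G = {p u, p v}) \<and>
     (\<forall>(u, v) \<in> parcs G. \<forall>(x, y) \<in> parcs G. {u, v} \<noteq> {x, y} \<longrightarrow>
        path_image (g (u, v)) \<inter> path_image (g (x, y)) \<subseteq> p ` ({u, v} \<inter> {x, y}))"

definition drawing_image ::
    "'a pair_pre_digraph \<Rightarrow> ('a \<Rightarrow> complex) \<Rightarrow> ('a \<times> 'a \<Rightarrow> real \<Rightarrow> complex) \<Rightarrow> complex set" where
  "drawing_image G p g = p ` pverts G \<union> (\<Union>e \<in> parcs G. path_image (g e))"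

text \<open>
  For a finite graph the drawing is compact, so \<^const>\<open>outside\<close> is the unique unbounded
  component of its complement, that is, the outer face. Faces are open sets disjoint from the
  drawing; a vertex belongs to a face if it lies on its boundary.
\<close>

definition outerplanar :: "'a pair_pre_digraph \<Rightarrow> bool" where
  "outerplanar G \<longleftrightarrow>
     (\<exists>p g. planar_drawing G p g \<and>
        (\<forall>v \<in> pverts G. p v \<in> frontier (outside (drawing_image G p g))))"

definition circular_dist :: "nat \<Rightarrow> nat \<Rightarrow> nat \<Rightarrow> int" where
  "circular_dist k i j = min \<bar>int i - int j\<bar> (int k - \<bar>int i - int j\<bar>)"

text \<open>The \<open>(k/2, t)\<^sup>*\<close>-colorings; note that \<open>k\<close> is the numerator, i.e. the number of colors.\<close>

definition half_star_coloring ::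
    "nat \<Rightarrow> nat \<Rightarrow> 'a pair_pre_digraph \<Rightarrow> ('a \<Rightarrow> nat) \<Rightarrow> bool" where
  "half_star_coloring k t G f \<longleftrightarrow>
     (\<forall>u \<in> pverts G. f u < k) \<and>
     (\<forall>(u, v) \<in> parcs G. f u \<noteq> f v) \<and>
     (\<forall>u \<in> pverts G. card {v. (u, v) \<in> parcs G \<and> circular_dist k (f u) (f v) = 1} \<le> t)"

definition half_star_colorable :: "nat \<Rightarrow> nat \<Rightarrow> 'a pair_pre_digraph \<Rightarrow> bool" where
  "half_star_colorable k t G \<longleftrightarrow> (\<exists>f. half_star_coloring k t G f)"

end

theory Submission
  imports Defs
begin

text \<open>
  Among any three distinct colors modulo 5, two are at circular distance 1, so in a
  \<open>(5/2, 1)\<^sup>*\<close>-coloring the edges of circular distance 1 form a matching that meets every triangle.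
  In a fan over a path with at least six vertices this is impossible: the hub has at most one
  matching spoke, which serves at most two consecutive triangles, and among any five consecutive
  triangles this leaves two consecutive ones whose rim edges would both have to be in the matching.
\<close>

text \<open>Vertex 0 is the hub and 1, ..., n is the rim path. The pair {0, 1} also fits the
  successor clauses, but is treated as a spoke below.\<close>

definition fan :: "nat \<Rightarrow> nat pair_pre_digraph" where
  "fan n = \<lparr>pverts = {..n},
     parcs = {(u, v). u \<le> n \<and> v \<le> n \<and> u \<noteq> v \<and> (u = 0 \<or> v = 0 \<or> v = Suc u \<or> u = Suc v)}\<rparr>"

lemma pverts_fan [simp]: "pverts (fan n) = {..n}"
  by (simp add: fan_def)

lemma parcs_fan_iff [simp]:
  "(u, v) \<in> parcs (fan n) \<longleftrightarrow>
     u \<le> n \<and> v \<le> n \<and> u \<noteq> v \<and> (u = 0 \<or> v = 0 \<or> v = Suc u \<or> u = Suc v)"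
  by (simp add: fan_def)

lemma pair_graph_fan: "pair_graph (fan n)"
proof
  show "finite (parcs (fan n))"
    by (rule finite_subset[of _ "{..n} \<times> {..n}"]) auto
  show "symmetric (with_proj (fan n))"
    by (auto simp: symmetric_def intro!: symI)
qed auto

text \<open>With the hub at the origin and the rim on the line Re = 1, straight edges suffice: the
  spoke to i has slope i, and each vertex lies on the boundary of a strip that contains the whole
  drawing.\<close>

definition fan_point :: "nat \<Rightarrow> complex" where
  "fan_point i = (if i = 0 then 0 else Complex 1 (real i))"

definition fan_edge :: "nat \<times> nat \<Rightarrow> real \<Rightarrow> complex" where
  "fan_edge = (\<lambda>(u, v). linepath (fan_point u) (fan_point v))"

lemma fan_point_0 [simp]: "fan_point 0 = 0"
  by (simp add: fan_point_def)

lemma fan_point_pos [simp]: "i > 0 \<Longrightarrow> fan_point i = Complex 1 (real i)"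
  by (simp add: fan_point_def)

lemma inj_fan_point: "inj fan_point"
  by (auto simp: inj_def fan_point_def complex_eq_iff)

lemma spokeD:
  assumes "z \<in> closed_segment (fan_point 0) (fan_point i)" "i > 0"
  shows "Im z = real i * Re z" "0 \<le> Re z" "Re z \<le> 1"
  using assms by (auto simp: in_segment)

lemma rimD:
  assumes "z \<in> closed_segment (fan_point i) (fan_point (Suc i))" "i > 0"
  shows "Re z = 1" "real i \<le> Im z" "Im z \<le> real (Suc i)"
proof -
  obtain t where "0 \<le> t" "t \<le> 1"
    and z: "z = (1 - t) *\<^sub>R Complex 1 (real i) + t *\<^sub>R Complex 1 (real (Suc i))"
    using assms by (auto simp: in_segment)
  moreover have "Re z = 1" "Im z = real i + t"
    by (simp_all add: z algebra_simps)
  ultimately show "Re z = 1" "real i \<le> Im z" "Im z \<le> real (Suc i)" by auto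
qed

text \<open>Removes the orientation of arcs: both arcs of an edge have the same segment as image, so
  later case splits need only one form of spoke and one of rim edge.\<close>

lemma fan_edge_cases:
  assumes "(u, v) \<in> parcs (fan n)"
  obtains (spoke) i where "0 < i" "{u, v} = {0, i}"
      "path_image (fan_edge (u, v)) = closed_segment (fan_point 0) (fan_point i)"
    | (rim) i where "0 < i" "{u, v} = {i, Suc i}"
      "path_image (fan_edge (u, v)) = closed_segment (fan_point i) (fan_point (Suc i))"
proof -
  have *: "path_image (fan_edge (u, v)) = closed_segment (fan_point u) (fan_point v)"
          "path_image (fan_edge (u, v)) = closed_segment (fan_point v) (fan_point u)"
    by (simp_all add: fan_edge_def closed_segment_commute)
  consider "u = 0" "v > 0" | "v = 0" "u > 0" | "u > 0" "v = Suc u" | "v > 0" "u = Suc v"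
    using assms by auto
  then show thesis
    using * spoke rim by cases (metis insert_commute)+
qed

lemma fan_edge_meets_points:
  assumes "(u, v) \<in> parcs (fan n)" "fan_point w \<in> path_image (fan_edge (u, v))"
  shows "w \<in> {u, v}"
  using assms(1)
proof (cases rule: fan_edge_cases)
  case (spoke i)
  with assms(2) spokeD[of "fan_point w" i] show ?thesis
    by (cases "w = 0") auto
next
  case (rim i)
  with assms(2) rimD[of "fan_point w" i] show ?thesis
    by (cases "w = 0") auto
qed

text \<open>Two lines through the origin with different slopes i and j: i * Re z = j * Re z forces
  Re z = 0.\<close>

lemma spoke_Int_spoke:
  assumes "z \<in> closed_segment (fan_point 0) (fan_point i)"
    "z \<in> closed_segment (fan_point 0) (fan_point j)" "i > 0" "j > 0" "i \<noteq> j"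
  shows "z = fan_point 0"
  using spokeD[of z i] spokeD[of z j] assms by (auto simp: complex_eq_iff)

text \<open>On the rim Re z = 1, and the spoke of slope i attains this only at its outer
  end.\<close>

lemma spoke_Int_rim:
  assumes "z \<in> closed_segment (fan_point 0) (fan_point i)"
    "z \<in> closed_segment (fan_point j) (fan_point (Suc j))" "i > 0" "j > 0"
  shows "z = fan_point i"
  using spokeD[of z i] rimD[of z j] assms by (auto simp: complex_eq_iff)

text \<open>The heights on the two edges satisfy Im z \<le> i + 1 \<le> j \<le> Im z, so all are
  equal.\<close>

lemma rim_Int_rim:
  assumes "z \<in> closed_segment (fan_point i) (fan_point (Suc i))"
    "z \<in> closed_segment (fan_point j) (fan_point (Suc j))" "i > 0" "i < j"
  shows "z = fan_point j"
  using rimD[of z i] rimD[of z j] assms by (auto simp: complex_eq_iff)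

text \<open>It is enough to land on some \<open>fan_point w\<close>: applying
  \<open>fan_edge_meets_points\<close> to both edges then shows that w is a common end.\<close>

lemma fan_edges_Int:
  assumes uv: "(u, v) \<in> parcs (fan n)" and xy: "(x, y) \<in> parcs (fan n)"
    and ne: "{u, v} \<noteq> {x, y}"
    and z: "z \<in> path_image (fan_edge (u, v))" "z \<in> path_image (fan_edge (x, y))"
  shows "z \<in> range fan_point"
  using uv
proof (cases rule: fan_edge_cases)
  case uv: (spoke i)
  show ?thesis
    using xy
  proof (cases rule: fan_edge_cases)
    case xy: (spoke j)
    then have "i \<noteq> j" using uv ne by auto
    then show ?thesis using spoke_Int_spoke[of z i j] uv(1,3) xy(1,3) z by (metis rangeI)
  next
    case xy: (rim j)
    then show ?thesis using spoke_Int_rim[of z i j] uv(1,3) z by (metis rangeI)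
  qed
next
  case uv: (rim i)
  show ?thesis
    using xy
  proof (cases rule: fan_edge_cases)
    case xy: (spoke j)
    then show ?thesis using spoke_Int_rim[of z j i] uv(1,3) z by (metis rangeI)
  next
    case xy: (rim j)
    then have "i < j \<or> j < i" using uv ne by auto
    then show ?thesis using rim_Int_rim[of z i j] rim_Int_rim[of z j i] uv(1,3) xy(1,3) z by (metis rangeI)
  qed
qed

lemma planar_drawing_fan: "planar_drawing (fan n) fan_point fan_edge"
  unfolding planar_drawing_def
proof (intro conjI ballI, goal_cases)
  case 1
  show ?case using inj_fan_point by (rule inj_on_subset) simp
next
  case (2 e)
  then obtain u v where e: "e = (u, v)" and uv: "(u, v) \<in> parcs (fan n)" by (cases e) auto
  have "path_image (fan_edge (u, v)) \<inter> fan_point ` {..n} \<subseteq> {fan_point u, fan_point v}"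
    using fan_edge_meets_points[OF uv] by blast
  moreover have "{fan_point u, fan_point v} \<subseteq> path_image (fan_edge (u, v)) \<inter> fan_point ` {..n}"
    using uv by (auto simp: fan_edge_def)
  ultimately have "path_image (fan_edge (u, v)) \<inter> fan_point ` {..n} = {fan_point u, fan_point v}"
    by (rule equalityI)
  then show ?case
    using uv inj_fan_point by (auto simp: e fan_edge_def inj_eq intro!: arc_linepath)
next
  case (3 e)
  then obtain u v where e: "e = (u, v)" and uv: "(u, v) \<in> parcs (fan n)" by (cases e) auto
  have "path_image (fan_edge (u, v)) \<inter> path_image (fan_edge (x, y)) \<subseteq> fan_point ` ({u, v} \<inter> {x, y})"
    if xy: "(x, y) \<in> parcs (fan n)" and ne: "{u, v} \<noteq> {x, y}" for x y
  proof
    fix z assume z: "z \<in> path_image (fan_edge (u, v)) \<inter> path_image (fan_edge (x, y))"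
    then obtain w where "z = fan_point w"
      using fan_edges_Int[OF uv xy ne] by blast
    then show "z \<in> fan_point ` ({u, v} \<inter> {x, y})"
      using z fan_edge_meets_points[OF uv] fan_edge_meets_points[OF xy] by blast
  qed
  then show ?case
    unfolding e prod.case by (intro ballI) (simp only: split_paired_all prod.case, blast)
qed

lemma convex_Re_strip: "convex {z. a \<le> Re z \<and> Re z \<le> b}"
  using convex_Int[OF convex_halfspace_Re_ge convex_halfspace_Re_le] by (simp add: Collect_conj_eq)

lemma drawing_image_fan_subset:
  "drawing_image (fan n) fan_point fan_edge \<subseteq> {z. 0 \<le> Re z \<and> Re z \<le> 1}"
proof -
  let ?S = "{z. 0 \<le> Re z \<and> Re z \<le> 1}"
  have "fan_point i \<in> ?S" for i
    by (simp add: fan_point_def)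
  then have "fan_point ` {..n} \<subseteq> ?S" "closed_segment (fan_point u) (fan_point v) \<subseteq> ?S" for u v
    using closed_segment_subset[OF _ _ convex_Re_strip] by blast+
  then show ?thesis
    unfolding drawing_image_def fan_edge_def by (intro Un_least UN_least) (auto split: prod.splits)
qed

text \<open>\<open>outside\<close> is antitone, and the outside of a convex set is its entire
  complement.\<close>

lemma outside_drawing_image_fan:
  "- {z. 0 \<le> Re z \<and> Re z \<le> 1} \<subseteq> outside (drawing_image (fan n) fan_point fan_edge)"
  using outside_mono[OF drawing_image_fan_subset] outside_convex[OF convex_Re_strip] by blast

lemma fan_point_in_frontier_outside:
  assumes "i \<le> n"
  shows "fan_point i \<in> frontier (outside (drawing_image (fan n) fan_point fan_edge))"
proof -
  let ?D = "drawing_image (fan n) fan_point fan_edge"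
  have "fan_point i \<in> ?D"
    using assms by (auto simp: drawing_image_def)
  then have "fan_point i \<notin> interior (outside ?D)"
    using interior_subset outside_no_overlap by blast
  moreover have "fan_point i \<in> closure (outside ?D)"
    unfolding closure_approachable
  proof (intro allI impI)
    fix e :: real assume "e > 0"
    \<comment> \<open>The hub is on the left side of the strip and the rim on its right side, so a
      horizontal shift by e / 2 in the matching direction leaves the strip.\<close>
    define d where "d = (if i = 0 then - e / 2 else e / 2)"
    have "fan_point i + of_real d \<in> - {z. 0 \<le> Re z \<and> Re z \<le> 1}"
      using \<open>e > 0\<close> by (auto simp: d_def fan_point_def)
    then have "fan_point i + of_real d \<in> outside ?D"
      using outside_drawing_image_fan by blast
    moreover have "dist (fan_point i + of_real d) (fan_point i) < e"
      using \<open>e > 0\<close> by (simp add: dist_norm d_def)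
    ultimately show "\<exists>y\<in>outside ?D. dist y (fan_point i) < e" by blast
  qed
  ultimately show ?thesis by (simp add: frontier_def)
qed

lemma outerplanar_fan: "outerplanar (fan n)"
  unfolding outerplanar_def
  using planar_drawing_fan fan_point_in_frontier_outside by (metis pverts_fan atMost_iff)

lemma circular_dist_commute: "circular_dist k i j = circular_dist k j i"
  by (simp add: circular_dist_def abs_minus_commute)

text \<open>Distinct colors modulo 5 are at circular distance 1 or 2, and the pairs at distance 2
  form a 5-cycle, which has no triangle.\<close>

lemma three_colors_mod_5:
  assumes "a < 5" "b < 5" "c < 5" "a \<noteq> b" "a \<noteq> c" "b \<noteq> c"
  shows "circular_dist 5 a b = 1 \<or> circular_dist 5 a c = 1 \<or> circular_dist 5 b c = 1"
proof -
  have "a \<in> {0, 1, 2, 3, 4}" "b \<in> {0, 1, 2, 3, 4}" "c \<in> {0, 1, 2, 3, 4}"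
    using assms(1-3) by auto
  then show ?thesis
    using assms(4-6) by (auto simp: circular_dist_def)
qed

lemma fan_not_colorable:
  assumes "n \<ge> 6"
  shows "\<not> half_star_colorable 5 1 (fan n)"
proof
  assume "half_star_colorable 5 1 (fan n)"
  then obtain f where f: "half_star_coloring 5 1 (fan n) f"
    by (auto simp: half_star_colorable_def)
  define M where "M u v \<longleftrightarrow> (u, v) \<in> parcs (fan n) \<and> circular_dist 5 (f u) (f v) = 1" for u v
  have M_sym: "M v u" if "M u v" for u v
    using that by (auto simp: M_def circular_dist_commute)
  have M_unique: "v = w" if "M u v" "M u w" for u v w
  proof -
    \<comment> \<open>Finiteness matters because \<open>card\<close> is 0 on infinite sets, where
      the bound would not give uniqueness.\<close>
    have "finite {v. M u v}"
      by (rule finite_subset[of _ "{..n}"]) (auto simp: M_def)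
    moreover have "card {v. M u v} \<le> Suc 0"
      using f that by (simp add: half_star_coloring_def M_def)
    ultimately show ?thesis
      using that by (auto simp: card_le_Suc0_iff_eq)
  qed
  have triangle: "M 0 i \<or> M 0 (Suc i) \<or> M i (Suc i)" if "0 < i" "i < n" for i
  proof -
    have arcs: "(0, i) \<in> parcs (fan n)" "(0, Suc i) \<in> parcs (fan n)" "(i, Suc i) \<in> parcs (fan n)"
      using that by simp_all
    have "f 0 < 5" "f i < 5" "f (Suc i) < 5" "f 0 \<noteq> f i" "f 0 \<noteq> f (Suc i)" "f i \<noteq> f (Suc i)"
      using f that arcs by (auto simp: half_star_coloring_def)
    then show ?thesis
      using three_colors_mod_5 arcs unfolding M_def by blast
  qed
  \<comment> \<open>If the hub is unmatched, any j will do.\<close>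
  have "\<exists>j. \<forall>i. M 0 i \<longrightarrow> i = j"
    using M_unique by (cases "\<exists>j. M 0 j") blast+
  then obtain j where j: "\<And>i. M 0 i \<Longrightarrow> i = j"
    by blast
  \<comment> \<open>Otherwise no spoke of the triangles over i, i + 1 and i + 1, i + 2 is in
    \<open>M\<close>, so both rim edges are, and they share the vertex i + 1.\<close>
  have rim: "j = i \<or> j = Suc i \<or> j = Suc (Suc i)" if "0 < i" "Suc i < n" for i
  proof (rule ccontr)
    assume "\<not> ?thesis"
    then have "M i (Suc i)" "M (Suc i) (Suc (Suc i))"
      using triangle[of i] triangle[of "Suc i"] j that by auto
    then show False
      using M_unique[of "Suc i" i "Suc (Suc i)"] M_sym by simp
  qed
  show False
    \<comment> \<open>These place j in the disjoint sets {1, 2, 3} and {4, 5, 6}; the second needs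
      rim vertex 6, hence n \<ge> 6.\<close>
    using rim[of 1] rim[of 4] assms by auto
qed

theorem theorem5p2:
  shows "\<exists>G :: nat pair_pre_digraph. pair_graph G \<and> outerplanar G \<and> \<not> half_star_colorable 5 1 G"
  using pair_graph_fan outerplanar_fan fan_not_colorable by blast

end
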